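(* Let $p$ and $q$ be distinct primes with $\gcd(p-1,q-1)=4$, and let $g,h,D_0,D_1,D_2,D_3$, the polynomials $D_k(X)$, the quaternary sequence $(e_u)$ over $\mathbb{Z}_4$ and $\ell$ be as defined in the context. Let $\beta\in GR(4,4^{\ell})$ be a primitive $pq$-th root of unity. If $p\equiv 5 \pmod 8$ and $q\equiv 1\pmod 8$, then the Mattson-Solomon polynomial $G(X)$ (corresponding to $\beta$) of $(e_u)$ is $$G(X)=2+\sum_{k=0}^{3}(\rho+2-k)D_k(X),$$ where $\rho=D_1(\beta)+2D_2(\beta)+3D_3(\beta)$.
   Context: $\mathbb{Z}_m=\{0,1,\dots,m-1\}$ is the residue class ring modulo $m$. $p,q$ are distinct primes with $\gcd(p-1,q-1)=4$, and $e=(p-1)(q-1)/4$. Fix an integer $g$ that is a common primitive root of both $p$ and $q$, and an integer $h$ with $h\equiv g\pmod p$, $h\equiv 1\pmod q$. The generalized cyclotomic classes of order $4$ modulo $pq$ are $D_i=\{g^sh^i \bmod pq: s=0,1,\dots,e-1\}\subseteq\{0,\dots,pq-1\}$ for $0\le i<4$; they partition $\mathbb{Z}_{pq}^*$. Put $D_i(X)=\sum_{u\in D_i}X^u\in\mathbb{Z}_4[X]$. Let $P=\{p,2p,\dots,(q-1)p\}$, $Q=\{q,2q,\dots,(p-1)q\}$, $R=\{0\}$. The sequence $(e_u)_{u\ge 0}$ over $\mathbb{Z}_4$ of period $pq$ is: $e_u=2$ if $u\bmod pq\in Q\cup R$; $e_u=0$ if $u\bmod pq\in P$; $e_u=i$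 if $u\bmod pq\in D_i$, $i=0,1,2,3$. $\ell$ is the multiplicative order of $2$ modulo $pq$. $GR(4,4^r)$ is the Galois ring $\mathbb{Z}_4[X]/(f(X))$ of characteristic $4$ with $4^r$ elements, where $f$ has degree $r$ and is irreducible modulo $2$. A primitive $pq$-th root of unity is a unit of multiplicative order exactly $pq$. Mattson-Solomon polynomial: for a sequence $(s_u)$ over $\mathbb{Z}_4$ of period $T=pq$ and a primitive $T$-th root of unity $\alpha\in GR(4,4^{\ell})$, the Mattson-Solomon polynomial of $(s_u)$ corresponding to $\alpha$ is $G(X)=\sum_{0\le i<T}\rho_iX^i\in GR(4,4^{\ell})[X]$ with $\rho_i=\sum_{0\le u<T}s_u\alpha^{-iu}$; it satisfies $s_u=G(\alpha^u)$ for all $u\ge 0$, and is uniquely determined modulo $X^T-1$ by this property. *)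

theory Defs
  imports
    "HOL-Library.Numeral_Type"
    "HOL-Library.Z2"
    "HOL-Number_Theory.Number_Theory"
    "HOL-Computational_Algebra.Computational_Algebra"
begin

(* Z_4 is the numeral type 4, whose representatives are 0, ..., 3.  This map is the canonical
   ring homomorphism Z_4 \<rightarrow> 'a whenever 4 = 0 in 'a: in particular the inclusion of Z_4 in a
   ring of characteristic 4, and the reduction modulo 2 if 'a = bit. *)
definition of_Z4 :: "4 \<Rightarrow> 'a::comm_ring_1" where
  "of_Z4 c = of_int (Rep_bit0 c)"

(* The ring 'a is the Galois ring GR(4,4^r), i.e. 'a \<cong> Z_4[X]/(f) for some monic f of degree r that
   is irreducible modulo 2.  The isomorphism is given by the surjection phi : Z_4[X] \<rightarrow> 'a with
   kernel (f). *)
definition galois_ring_4 :: "'a::comm_ring_1 itself \<Rightarrow> nat \<Rightarrow> bool" where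
  "galois_ring_4 TYPE('a) r \<longleftrightarrow>
    (\<exists>(f :: 4 poly) (\<phi> :: 4 poly \<Rightarrow> 'a).
       lead_coeff f = 1 \<and> degree f = r \<and> irreducible (map_poly of_Z4 f :: bit poly) \<and>
       \<phi> 1 = 1 \<and> (\<forall>P Q. \<phi> (P + Q) = \<phi> P + \<phi> Q) \<and> (\<forall>P Q. \<phi> (P * Q) = \<phi> P * \<phi> Q) \<and>
       surj \<phi> \<and> (\<forall>P. \<phi> P = 0 \<longleftrightarrow> f dvd P))"

definition primitive_unity_root :: "nat \<Rightarrow> 'a::comm_ring_1 \<Rightarrow> bool" where
  "primitive_unity_root T a \<longleftrightarrow>
     a dvd 1 \<and> a ^ T = 1 \<and> (\<forall>k. 0 < k \<and> k < T \<longrightarrow> a ^ k \<noteq> 1)"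

definition unit_inverse :: "'a::comm_ring_1 \<Rightarrow> 'a" where
  "unit_inverse a = (THE b. a * b = 1)"

definition mattson_solomon :: "nat \<Rightarrow> (nat \<Rightarrow> 4) \<Rightarrow> 'a::comm_ring_1 \<Rightarrow> 'a poly" where
  "mattson_solomon T s \<alpha> =
     (\<Sum>i<T. monom (\<Sum>u<T. of_Z4 (s u) * unit_inverse \<alpha> ^ (i * u)) i)"

(* residue_primroot is about natural numbers, hence the least nonnegative residue of g *)
definition int_primroot :: "nat \<Rightarrow> int \<Rightarrow> bool" where
  "int_primroot n g \<longleftrightarrow> residue_primroot n (nat (g mod int n))"

definition cyc_class :: "nat \<Rightarrow> nat \<Rightarrow> int \<Rightarrow> int \<Rightarrow> nat \<Rightarrow> nat set" where
  "cyc_class p q g h i =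
     {nat (g ^ s * h ^ i mod int (p * q)) | s. s < (p - 1) * (q - 1) div 4}"

definition cyc_poly :: "nat \<Rightarrow> nat \<Rightarrow> int \<Rightarrow> int \<Rightarrow> nat \<Rightarrow> 4 poly" where
  "cyc_poly p q g h i = (\<Sum>u\<in>cyc_class p q g h i. monom 1 u)"

(* The case distinction is complete because the classes with index < 4 partition the units
   modulo p * q. *)
definition quaternary_seq :: "nat \<Rightarrow> nat \<Rightarrow> int \<Rightarrow> int \<Rightarrow> nat \<Rightarrow> 4" where
  "quaternary_seq p q g h u =
     (let v = u mod (p * q);
          P = {j * p | j. 1 \<le> j \<and> j \<le> q - 1};
          Q = {j * q | j. 1 \<le> j \<and> j \<le> p - 1};
          R = {0}
      in if v \<in> Q \<union> R then 2
         else if v \<in> P then 0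
         else of_nat (THE i. i < 4 \<and> v \<in> cyc_class p q g h i))"

end

theory Submission
  imports Defs
begin

text \<open>
  The coefficient of \<open>X\<^sup>i\<close> is twice a geometric sum of powers of \<open>\<beta>\<close> plus \<open>\<Sum>m<4. m * D\<^sub>m(\<beta>\<^sup>-\<^sup>i)\<close>. In the
  Galois ring a root of unity of odd order other than 1 is not congruent to 1 modulo 2, so its geometric
  sums over a full period vanish. If \<open>i\<close> is not a unit, \<open>D\<^sub>m(\<beta>\<^sup>-\<^sup>i)\<close> does not depend on \<open>m\<close> and is one of
  \<open>e\<close>, \<open>- (p - 1) / 4\<close>, \<open>- (q - 1) / 4\<close>, whose residues modulo 4 or 2 are known. If \<open>i \<in> D\<^sub>k\<close>, multiplication by
  \<open>- i\<close> maps \<open>D\<^sub>m\<close> onto the class with index \<open>m + k + 2\<close>, because \<open>- 1\<close> has index 2; since the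
  \<open>D\<^sub>m(\<beta>)\<close> add up to 1, the coefficient is \<open>\<rho> - (k + 2)\<close>.
\<close>

section \<open>Galois rings of characteristic 4\<close>

lemma Z4_induct:
  assumes "P 0" "P 1" "P 2" "P 3"
  shows "P (c :: 4)"
proof (cases c rule: bit0_cases)
  case (of_int z)
  then have "z = 0 \<or> z = 1 \<or> z = 2 \<or> z = 3" by (simp, presburger)
  then have "c = of_int 0 \<or> c = of_int 1 \<or> c = of_int 2 \<or> c = of_int 3"
    unfolding of_int(1) by blast
  then show ?thesis using assms unfolding of_int_0 of_int_1 of_int_numeral by metis
qed

lemma of_Z4_0 [simp]: "of_Z4 0 = 0"
  unfolding of_Z4_def bit0.Rep_0 by (rule of_int_0)

lemma of_Z4_1 [simp]: "of_Z4 1 = 1"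
  unfolding of_Z4_def bit0.Rep_1 by (rule of_int_1)

lemma of_Z4_numeral [simp]: "of_Z4 (numeral w) = of_int (numeral w mod 4)"
  unfolding of_Z4_def bit0.Rep_numeral by simp

section \<open>Reduction of polynomials over Z_4 modulo 2\<close>

lemma of_Z4_bit_add: "(of_Z4 (a + b) :: bit) = of_Z4 a + of_Z4 b"
  by (induction a rule: Z4_induct; induction b rule: Z4_induct; simp)

lemma of_Z4_bit_mult: "(of_Z4 (a * b) :: bit) = of_Z4 a * of_Z4 b"
  by (induction a rule: Z4_induct; induction b rule: Z4_induct; simp)

lemma of_Z4_bit_sum: "(of_Z4 (sum f A) :: bit) = (\<Sum>i\<in>A. of_Z4 (f i))"
  by (induction A rule: infinite_finite_induct) (simp_all add: of_Z4_bit_add)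

abbreviation reduce2 :: "4 poly \<Rightarrow> bit poly" where
  "reduce2 \<equiv> map_poly of_Z4"

lemma reduce2_add: "reduce2 (P + Q) = reduce2 P + reduce2 Q"
  by (intro poly_eqI) (simp add: coeff_map_poly of_Z4_bit_add)

lemma reduce2_mult: "reduce2 (P * Q) = reduce2 P * reduce2 Q"
  by (intro poly_eqI) (simp add: coeff_map_poly coeff_mult of_Z4_bit_sum of_Z4_bit_mult)

lemma reduce2_eq_0_iff: "reduce2 P = 0 \<longleftrightarrow> 2 dvd P"
proof
  assume red: "reduce2 P = 0"
  have even: "\<exists>d::4. coeff P n = 2 * d" for n
  proof -
    have "(of_Z4 (coeff P n) :: bit) = 0"
      using red by (metis coeff_0 coeff_map_poly of_Z4_0)
    moreover have "(of_Z4 c :: bit) = 0 \<longrightarrow> c = 2 * 0 \<or> c = 2 * 1" for c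
      by (induction c rule: Z4_induct) simp_all
    ultimately show ?thesis by blast
  qed
  \<comment> \<open>\<open>half\<close> fixes 0 so that \<open>map_poly\<close> acts
    coefficientwise; at other even elements it picks some half.\<close>
  define half :: "4 \<Rightarrow> 4" where "half c = (if c = 0 then 0 else (SOME d. c = 2 * d))" for c
  have "coeff P n = 2 * half (coeff P n)" for n
    using someI_ex[OF even[of n]] by (simp add: half_def)
  then have "P = smult 2 (map_poly half P)"
    by (intro poly_eqI) (simp add: coeff_map_poly half_def)
  then have "P = 2 * map_poly half P"
    by (simp add: numeral_poly)
  then show "2 dvd P" by (rule dvdI)
next
  assume "2 dvd P"
  then obtain Q where "P = 2 * Q" ..
  moreover have "reduce2 2 = 0"
    by (intro poly_eqI) (simp add: coeff_map_poly numeral_poly coeff_pCons split: nat.splits)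
  ultimately show "reduce2 P = 0" by (simp add: reduce2_mult)
qed

lemma reduce2_surj: "\<exists>P. reduce2 P = B"
proof -
  define lift :: "bit \<Rightarrow> 4" where "lift b = (if b = 0 then 0 else 1)" for b
  have "reduce2 (map_poly lift B) = B"
    by (intro poly_eqI) (auto simp: coeff_map_poly lift_def)
  then show ?thesis ..
qed

text \<open>Coefficientwise: \<open>2 * c = 0\<close> in Z_4 leaves only 0 and 2 for
  \<open>c\<close>.\<close>

lemma two_mult_eq_0_imp:
  assumes "2 * P = (0 :: 4 poly)"
  shows "2 dvd P"
proof -
  have "reduce2 P = 0"
  proof (rule poly_eqI)
    fix n
    have "2 * coeff P n = coeff (2 * P) n"
      by (simp add: numeral_poly)
    also have "\<dots> = 0" unfolding assms by (rule coeff_0)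
    finally have "2 * coeff P n = 0" .
    moreover have "2 * c = 0 \<longrightarrow> (of_Z4 c :: bit) = 0" for c
      by (induction c rule: Z4_induct) simp_all
    ultimately have "(of_Z4 (coeff P n) :: bit) = 0" by blast
    then show "coeff (reduce2 P) n = coeff 0 n"
      by (simp add: coeff_map_poly)
  qed
  then show ?thesis by (simp add: reduce2_eq_0_iff)
qed

lemma four_eq_0_Z4_poly: "(4 :: 4 poly) = 0"
  by (simp add: numeral_poly)

text \<open>The proof uses no more of a Galois ring than this: the ideal generated by 2 is prime and equal to
  its own annihilator. The fixed type token only serves to pass the ring as a locale parameter.\<close>

locale galois_ring_4_like =
  fixes ring_type :: "'a::comm_ring_1 itself"
  assumes four_eq_0: "(4 :: 'a) = 0"
    and two_annihilator: "2 * x = (0::'a) \<Longrightarrow> 2 dvd x"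
    and two_prime: "2 dvd x * y \<Longrightarrow> 2 dvd x \<or> 2 dvd (y :: 'a)"

text \<open>Divisibility by 2 in the ring becomes divisibility by \<open>reduce2 f\<close> over the
  field with two elements, where irreducible elements are prime. For the annihilator,
  \<open>2 * P = f * A\<close> reduces to \<open>reduce2 f * reduce2 A = 0\<close>, so
  \<open>A = 2 * A'\<close>; then 2 annihilates \<open>P - f * A'\<close>, and this difference,
  which has the same image as \<open>P\<close>, is even.\<close>

lemma galois_ring_4_imp_like:
  assumes "galois_ring_4 TYPE('a::comm_ring_1) r"
  shows "galois_ring_4_like TYPE('a)"
proof -
  from assms obtain f and \<phi> :: "4 poly \<Rightarrow> 'a" where
    irr: "irreducible (reduce2 f)" and
    one: "\<phi> 1 = 1" and add: "\<forall>P Q. \<phi> (P + Q) = \<phi> P + \<phi> Q" and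
    mult: "\<forall>P Q. \<phi> (P * Q) = \<phi> P * \<phi> Q" and
    surj: "surj \<phi>" and ker: "\<forall>P. \<phi> P = 0 \<longleftrightarrow> f dvd P"
    unfolding galois_ring_4_def by (elim exE conjE) (rule that)
  note add = add[rule_format] and mult = mult[rule_format] and ker = ker[rule_format]
  have two: "\<phi> 2 = 2" using add[of 1 1] one by simp
  have four: "\<phi> 4 = 4" using add[of 2 2] two by simp
  have zero: "\<phi> 0 = 0" by (simp add: ker)
  have diff: "\<phi> (P - Q) = \<phi> P - \<phi> Q" for P Q
    using add[of "P - Q" Q] by simp
  have prime: "prime_elem (reduce2 f)"
    using irr by (rule field_poly_irreducible_imp_prime)
  have even_iff: "2 dvd \<phi> P \<longleftrightarrow> reduce2 f dvd reduce2 P" for P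
  proof
    assume "2 dvd \<phi> P"
    then obtain y where "\<phi> P = 2 * y" ..
    moreover obtain S where "y = \<phi> S" using surj by (metis surjD)
    ultimately have "\<phi> (P - 2 * S) = 0" by (simp add: diff mult two)
    then obtain A where A: "P - 2 * S = f * A" by (auto simp: ker)
    have "P = 2 * S + f * A" using A by (simp add: algebra_simps)
    then have "reduce2 P = reduce2 (2 * S) + reduce2 f * reduce2 A"
      by (simp only: reduce2_add reduce2_mult[of f])
    moreover have "reduce2 (2 * S) = 0" by (simp add: reduce2_eq_0_iff)
    ultimately show "reduce2 f dvd reduce2 P" by simp
  next
    assume "reduce2 f dvd reduce2 P"
    then obtain B where B: "reduce2 P = reduce2 f * B" ..
    obtain A where A: "reduce2 A = B" using reduce2_surj by blast
    have "reduce2 (P - f * A) + reduce2 (f * A) = reduce2 P"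
      by (simp flip: reduce2_add)
    then have "reduce2 (P - f * A) = 0" by (simp add: B reduce2_mult A)
    then obtain S where "P - f * A = 2 * S" by (auto simp: reduce2_eq_0_iff)
    then have "\<phi> P - \<phi> (f * A) = 2 * \<phi> S" by (metis diff mult two)
    moreover have "\<phi> (f * A) = 0" by (simp add: ker)
    ultimately show "2 dvd \<phi> P" by simp
  qed
  show ?thesis
  proof
    show "(4::'a) = 0" using four zero four_eq_0_Z4_poly by simp
  next
    fix x y :: 'a assume xy: "2 dvd x * y"
    obtain P Q where "x = \<phi> P" "y = \<phi> Q" using surj by (metis surjD)
    with xy prime show "2 dvd x \<or> 2 dvd y"
      by (auto simp: mult[symmetric] even_iff reduce2_mult prime_elem_dvd_mult_iff)
  next
    fix x :: 'a assume x: "2 * x = 0"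
    obtain P where P: "x = \<phi> P" using surj by (metis surjD)
    with x have "\<phi> (2 * P) = 0" by (simp add: mult two)
    then obtain A where A: "2 * P = f * A" by (auto simp: ker)
    have "reduce2 f * reduce2 A = reduce2 (2 * P)" by (simp add: A reduce2_mult)
    also have "\<dots> = 0" by (simp add: reduce2_eq_0_iff)
    finally have "reduce2 A = 0" using irr by auto
    then obtain A' where A': "A = 2 * A'" by (auto simp: reduce2_eq_0_iff)
    have "2 * (P - f * A') = 0" using A A' by (simp add: algebra_simps)
    then obtain S where "P - f * A' = 2 * S" by (blast dest: two_mult_eq_0_imp)
    then have "\<phi> P - \<phi> (f * A') = 2 * \<phi> S" by (metis diff mult two)
    moreover have "\<phi> (f * A') = 0" by (simp add: ker)
    ultimately show "2 dvd x" by (simp add: P)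
  qed
qed

context galois_ring_4_like
begin

lemma of_nat_eq_of_nat_mod_4: "(of_nat n :: 'a) = of_nat (n mod 4)"
proof -
  have "(of_nat n :: 'a) = of_nat (4 * (n div 4) + n mod 4)" by simp
  also have "\<dots> = of_nat (n mod 4)"
    by (simp only: of_nat_add of_nat_mult of_nat_numeral four_eq_0) simp
  finally show ?thesis .
qed

lemma of_nat_cong_4: "[m = n] (mod 4) \<Longrightarrow> (of_nat m :: 'a) = of_nat n"
  by (metis cong_def of_nat_eq_of_nat_mod_4)

text \<open>Two rounds of divisibility by 2: primality makes \<open>y = 2 * z\<close>, then the
  annihilator of 2 makes \<open>x * z\<close> even and hence \<open>z\<close> even. So
  \<open>y\<close> is a multiple of 4.\<close>

lemma mult_eq_0_imp:
  assumes xy: "x * y = (0::'a)" and x: "\<not> 2 dvd x"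
  shows "y = 0"
proof -
  have "2 dvd y" using two_prime[of x y] xy x by simp
  then obtain z where z: "y = 2 * z" ..
  have "2 * (x * z) = 0" using xy z by (simp add: ac_simps)
  then have "2 dvd z" using two_prime[of x z] two_annihilator x by blast
  then obtain w where "z = 2 * w" ..
  then have "y = 4 * w" using z by simp
  then show "y = 0" by (simp add: four_eq_0)
qed

text \<open>An element congruent to 1 modulo 2 has square 1, so it is no nontrivial root of unity of odd order.\<close>

lemma sum_powers_root_of_unity:
  assumes root: "\<omega> ^ n = (1::'a)" and "odd n" and "\<omega> \<noteq> 1"
  shows "(\<Sum>j<n. \<omega> ^ j) = 0"
proof -
  have "\<not> 2 dvd \<omega> - 1"
  proof
    assume "2 dvd \<omega> - 1"
    then obtain x where "\<omega> - 1 = 2 * x" ..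
    then have "\<omega> = 1 + 2 * x" by (simp add: algebra_simps)
    then have "\<omega>\<^sup>2 = 1 + 4 * (x + x\<^sup>2)" by (simp add: power2_eq_square algebra_simps)
    then have sq: "\<omega>\<^sup>2 = 1" by (simp add: four_eq_0)
    obtain m where "n = 2 * m + 1" using \<open>odd n\<close> by (rule oddE)
    then have "\<omega> ^ n = (\<omega>\<^sup>2) ^ m * \<omega>" by (simp add: power_mult)
    then show False using root sq \<open>\<omega> \<noteq> 1\<close> by simp
  qed
  moreover have "(\<omega> - 1) * (\<Sum>j<n. \<omega> ^ j) = 0"
    using power_diff_1_eq[of \<omega> n] root by simp
  ultimately show ?thesis using mult_eq_0_imp by blast
qed

end

section \<open>Discrete logarithms modulo a prime\<close>

text \<open>The Chinese remainder theorem for moduli with a common factor. It will glue logarithms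
  modulo \<open>p - 1\<close> and \<open>q - 1\<close>, whose gcd is 4.\<close>

lemma cong_gcd_solve_nat:
  fixes a b m n :: nat
  assumes "[a = b] (mod gcd m n)" and "m > 0" and "n > 0"
  obtains s where "s < lcm m n" "[s = a] (mod m)" "[s = b] (mod n)"
proof -
  \<comment> \<open>By Bezout, adding multiples of \<open>m * x\<close> moves \<open>a\<close> in
    steps of the gcd modulo \<open>n\<close> without changing it modulo \<open>m\<close>.\<close>
  obtain x where x: "[int m * x = gcd (int m) (int n)] (mod int n)"
    using cong_solve_int by blast
  have "[int b = int a] (mod gcd (int m) (int n))"
    using assms(1) by (metis cong_int_iff cong_sym gcd_int_int_eq)
  then obtain c where c: "int b - int a = gcd (int m) (int n) * c"
    by (auto simp: cong_iff_dvd_diff)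
  define t where "t = int a + int m * x * c"
  have "[int a + int m * x * c = int a + gcd (int m) (int n) * c] (mod int n)"
    using x by (intro cong_add cong_mult) auto
  then have tn: "[t = int b] (mod int n)" unfolding c[symmetric] t_def by simp
  have tm: "[t = int a] (mod int m)" by (simp add: t_def cong_iff_dvd_diff)
  define s where "s = nat (t mod int (lcm m n))"
  have pos: "lcm m n > 0" using assms lcm_pos_nat by blast
  then have s: "int s = t mod int (lcm m n)" by (simp add: s_def)
  then have "[int s = t] (mod int (lcm m n))" by simp
  then have "[int s = t] (mod int m)" "[int s = t] (mod int n)"
    by (meson cong_dvd_modulus dvd_lcm1 dvd_lcm2 int_dvd_int_iff)+
  with tn tm have "[s = a] (mod m)" "[s = b] (mod n)"
    by (metis cong_int_iff cong_trans)+
  moreover have "s < lcm m n" using s pos by (metis of_nat_0_less_iff of_nat_less_iff pos_mod_bound)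
  ultimately show ?thesis by (intro that)
qed

lemma sum_periodic:
  assumes "\<And>s. F (s + n) = (F s :: 'a::comm_semiring_1)"
  shows "(\<Sum>s<n * m. F s) = of_nat m * (\<Sum>s<n. F s)"
proof (induction m)
  case (Suc m)
  have shift: "F (s + n * m) = F s" for s
    by (induction m) (simp_all add: assms flip: add.assoc, metis add.assoc add.commute assms)
  have "(\<Sum>s<n * Suc m. F s) = (\<Sum>s<n * m. F s) + (\<Sum>s\<in>{n * m..<n * m + n}. F s)"
    by (subst sum.union_disjoint[symmetric]) (auto intro!: sum.cong)
  also have "(\<Sum>s\<in>{n * m..<n * m + n}. F s) = (\<Sum>s<n. F (s + n * m))"
    using sum.shift_bounds_nat_ivl[of F 0 "n * m" n] by (simp add: lessThan_atLeast0 add.commute)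
  finally show ?case by (simp only: shift Suc) (simp add: algebra_simps)
qed simp

lemma nat_mod_eq_iff_cong:
  assumes "n > 0"
  shows "nat (x mod int n) = nat (y mod int n) \<longleftrightarrow> [x = y] (mod int n)"
  using assms by (simp add: cong_def eq_nat_nat_iff)

lemma cong_nat_mod: "n > 0 \<Longrightarrow> [int (nat (x mod int n)) = x] (mod int n)"
  by simp

lemma nat_mod_less: "n > 0 \<Longrightarrow> nat (x mod int n) < n"
  by (simp add: nat_less_iff)

context
  fixes p :: nat and g :: int
  assumes prime: "prime p" and primroot: "int_primroot p g"
begin

text \<open>Orders and primitive roots live on natural numbers, so powers of the integer
  \<open>g\<close> are transferred to its least residue.\<close>

lemma int_primroot_power_eq_nat:
  "[g ^ a = int (nat (g mod int p) ^ a)] (mod int p)"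
proof -
  have "[g = int (nat (g mod int p))] (mod int p)"
    using cong_nat_mod[of p g] prime by (simp add: cong_sym prime_gt_0_nat)
  then show ?thesis by (metis cong_pow of_nat_power)
qed

lemma int_primroot_power_cong_iff:
  "[g ^ a = g ^ b] (mod int p) \<longleftrightarrow> [a = b] (mod (p - 1))"
proof -
  let ?G = "nat (g mod int p)"
  have "[g ^ a = g ^ b] (mod int p) \<longleftrightarrow> [int (?G ^ a) = int (?G ^ b)] (mod int p)"
    using int_primroot_power_eq_nat[of a] int_primroot_power_eq_nat[of b]
    by (meson cong_sym cong_trans)
  also have "\<dots> \<longleftrightarrow> [?G ^ a = ?G ^ b] (mod p)" by (rule cong_int_iff)
  also have "\<dots> \<longleftrightarrow> [a = b] (mod (p - 1))"
    using primroot prime order_divides_expdiff[of p ?G a b]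
    by (simp add: int_primroot_def residue_primroot_def totient_prime)
  finally show ?thesis .
qed

lemma int_primroot_log:
  assumes "\<not> p dvd v"
  obtains a where "[int v = g ^ a] (mod int p)"
proof -
  let ?G = "nat (g mod int p)"
  have p1: "p > 1" using prime by (rule prime_gt_1_nat)
  have "v mod p \<in> totatives p"
    using assms prime by (simp add: totatives_prime dvd_eq_mod_eq_0 prime_gt_0_nat)
  moreover have "(\<lambda>i. ?G ^ i mod p) ` {..<totient p} = totatives p"
    using residue_primroot_is_generator[OF p1, of ?G] primroot
    by (simp add: int_primroot_def bij_betw_def)
  ultimately have "v mod p \<in> (\<lambda>i. ?G ^ i mod p) ` {..<totient p}" by simp
  then obtain a where "v mod p = ?G ^ a mod p" by (elim imageE)
  then have "[int v = int (?G ^ a)] (mod int p)"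
    by (simp only: cong_int_iff) (simp only: cong_def)
  then show ?thesis using that int_primroot_power_eq_nat cong_sym cong_trans by blast
qed

lemma int_primroot_not_dvd: "\<not> int p dvd g ^ a"
proof -
  have "coprime (nat (g mod int p)) p"
    using primroot by (simp add: int_primroot_def residue_primroot_def coprime_commute)
  then have "\<not> p dvd nat (g mod int p) ^ a"
    using prime by (metis coprime_power_left_iff coprime_absorb_right not_prime_unit)
  then show ?thesis
    using int_primroot_power_eq_nat[of a] by (metis cong_dvd_iff int_dvd_int_iff)
qed

text \<open>The power is a square root of 1, hence 1 or -1 modulo the prime, and it is not 1 because
  \<open>g\<close> has order \<open>p - 1\<close>.\<close>

lemma int_primroot_half:
  assumes "odd p"
  shows "[g ^ ((p - 1) div 2) = - 1] (mod int p)"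
proof -
  let ?x = "g ^ ((p - 1) div 2)"
  have p: "p > 2" using prime assms
    by (metis prime_gt_1_nat le_neq_implies_less Suc_leI numeral_2_eq_2 even_numeral One_nat_def)
  have "?x\<^sup>2 = g ^ (p - 1)" using assms by (simp flip: power_mult)
  \<comment> \<open>Writing 1 as \<open>g ^ 0\<close> allows the exponents to be compared modulo
    \<open>p - 1\<close>.\<close>
  moreover have "[g ^ (p - 1) = g ^ 0] (mod int p)"
    by (simp only: int_primroot_power_cong_iff) (simp add: cong_def)
  ultimately have "int p dvd (?x - 1) * (?x + 1)"
    by (simp add: cong_iff_dvd_diff power2_eq_square algebra_simps)
  moreover have "\<not> int p dvd ?x - 1"
  proof
    assume "int p dvd ?x - 1"
    then have "[?x = g ^ 0] (mod int p)" by (simp add: cong_iff_dvd_diff)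
    then have "(p - 1) dvd (p - 1) div 2"
      by (simp only: int_primroot_power_cong_iff) (simp add: cong_def dvd_eq_mod_eq_0)
    then show False using p by (auto dest: dvd_imp_le)
  qed
  ultimately have "int p dvd ?x + 1" using prime by (simp add: prime_dvd_mult_iff)
  then show ?thesis by (simp add: cong_iff_dvd_diff)
qed

text \<open>Injectivity follows from the order of \<open>g\<close>, surjectivity by counting. The
  shift \<open>k\<close> accommodates the exponents \<open>s + i\<close> with which the class of
  index \<open>i\<close> appears modulo \<open>p\<close>.\<close>

lemma bij_betw_int_primroot_powers:
  "bij_betw (\<lambda>s. nat (g ^ (s + k) mod int p)) {..<p - 1} {1..<p}"
proof -
  let ?f = "\<lambda>s. nat (g ^ (s + k) mod int p)"
  have p: "p > 0" using prime by (rule prime_gt_0_nat)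
  have "inj_on ?f {..<p - 1}"
  proof (rule inj_onI)
    fix s t assume st: "s \<in> {..<p - 1}" "t \<in> {..<p - 1}" "?f s = ?f t"
    then have "[s + k = t + k] (mod (p - 1))"
      using p by (simp add: nat_mod_eq_iff_cong int_primroot_power_cong_iff)
    then have "[s = t] (mod (p - 1))" by (simp only: cong_add_rcancel_nat)
    then show "s = t" using st by (simp add: cong_less_modulus_unique_nat)
  qed
  moreover have "?f ` {..<p - 1} = {1..<p}"
  proof (rule card_subset_eq)
    show "?f ` {..<p - 1} \<subseteq> {1..<p}"
    proof (clarsimp, intro conjI)
      fix s
      show "nat (g ^ (s + k) mod int p) < p" using p by (rule nat_mod_less)
      have "g ^ (s + k) mod int p \<noteq> 0"
        using int_primroot_not_dvd[of "s + k"] by (simp add: dvd_eq_mod_eq_0)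
      moreover have "g ^ (s + k) mod int p \<ge> 0" using p by simp
      ultimately show "Suc 0 \<le> nat (g ^ (s + k) mod int p)" by linarith
    qed
    show "card (?f ` {..<p - 1}) = card {1..<p}"
      using \<open>inj_on ?f {..<p - 1}\<close> by (simp add: card_image)
  qed simp
  ultimately show ?thesis by (simp add: bij_betw_def)
qed

end

section \<open>Cyclotomic classes\<close>

locale cyclotomic_classes =
  fixes p q :: nat and g h :: int
  assumes p: "prime p" and q: "prime q" and p_neq_q: "p \<noteq> q"
    and gcd4: "gcd (p - 1) (q - 1) = 4"
    and primroot_p: "int_primroot p g" and primroot_q: "int_primroot q g"
    and h_p: "[h = g] (mod int p)" and h_q: "[h = 1] (mod int q)"
begin

abbreviation D :: "nat \<Rightarrow> nat set" where
  "D \<equiv> cyc_class p q g h"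

definition e :: nat where
  "e = (p - 1) * (q - 1) div 4"

definition elem :: "nat \<Rightarrow> nat \<Rightarrow> nat" where
  "elem i s = nat (g ^ s * h ^ i mod int (p * q))"

lemma D_eq: "D i = elem i ` {..<e}"
  by (auto simp: cyc_class_def elem_def e_def)

lemma finite_D [simp]: "finite (D i)"
  by (simp add: D_eq)

lemma pq_pos: "p * q > 0"
  using p q by (simp add: prime_gt_0_nat)

lemma coprime_pq: "coprime p q"
  using p q p_neq_q by (rule primes_coprime)

lemma dvd_pq: "4 dvd p - 1" "4 dvd q - 1"
  by (metis gcd4 gcd_dvd1) (metis gcd4 gcd_dvd2)

lemma e_eq_lcm: "e = lcm (p - 1) (q - 1)"
  unfolding e_def lcm_nat_def gcd4 ..

text \<open>Here and in \<open>e_eq_q\<close>, the \<open>e\<close> exponents of a class are split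
  into full periods of the powers of \<open>g\<close>: \<open>(q - 1) / 4\<close> periods modulo
  \<open>p\<close> and \<open>(p - 1) / 4\<close> modulo \<open>q\<close>.\<close>

lemma e_eq_p: "e = (p - 1) * ((q - 1) div 4)"
  using dvd_pq by (simp add: e_def div_mult_swap)

lemma e_eq_q: "e = (q - 1) * ((p - 1) div 4)"
  using dvd_pq by (simp add: e_def div_mult_swap mult.commute)

lemma odd_pq: "odd p" "odd q"
proof -
  obtain k l where "p - 1 = 4 * k" "q - 1 = 4 * l" using dvd_pq by (elim dvdE)
  then have "p = 2 * (2 * k) + 1" "q = 2 * (2 * l) + 1"
    using prime_gt_0_nat[OF p] prime_gt_0_nat[OF q] by simp_all
  then show "odd p" "odd q" by simp_all
qed

lemma cong_pq_iff: "[x = y] (mod int (p * q)) \<longleftrightarrow> [x = y] (mod int p) \<and> [x = y] (mod int q)"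
proof -
  have "coprime (int p) (int q)" using coprime_pq by simp
  then have "int p dvd x - y \<Longrightarrow> int q dvd x - y \<Longrightarrow> int p * int q dvd x - y"
    by (intro divides_mult)
  then show ?thesis
    unfolding cong_iff_dvd_diff of_nat_mult using dvd_mult_left dvd_mult_right by blast
qed

lemma elem_less: "elem i s < p * q"
  unfolding elem_def using pq_pos by (rule nat_mod_less)

lemma elem_cong_p: "[int (elem i s) = g ^ (s + i)] (mod int p)"
  and elem_cong_q: "[int (elem i s) = g ^ s] (mod int q)"
proof -
  have "[int (elem i s) = g ^ s * h ^ i] (mod int (p * q))"
    unfolding elem_def using pq_pos by (rule cong_nat_mod)
  then have "[int (elem i s) = g ^ s * h ^ i] (mod int p)" "[int (elem i s) = g ^ s * h ^ i] (mod int q)"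
    by (simp_all only: cong_pq_iff)
  moreover have "[g ^ s * h ^ i = g ^ s * g ^ i] (mod int p)"
    using h_p by (intro cong_mult cong_pow cong_refl)
  moreover have "[g ^ s * h ^ i = g ^ s * 1 ^ i] (mod int q)"
    using h_q by (intro cong_mult cong_pow cong_refl)
  ultimately show "[int (elem i s) = g ^ (s + i)] (mod int p)" "[int (elem i s) = g ^ s] (mod int q)"
    by (auto simp: power_add intro: cong_trans)
qed

text \<open>The class of a unit is the difference of its two discrete logarithms modulo 4.\<close>

lemma mem_D_iff:
  "v \<in> D i \<longleftrightarrow> v < p * q \<and>
    (\<exists>a b. [int v = g ^ a] (mod int p) \<and> [int v = g ^ b] (mod int q) \<and> [a = b + i] (mod 4))"
proof (intro iffI conjI)
  assume "v \<in> D i"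
  then obtain s where s: "v = elem i s" by (auto simp: D_eq)
  then show "v < p * q" by (simp add: elem_less)
  show "\<exists>a b. [int v = g ^ a] (mod int p) \<and> [int v = g ^ b] (mod int q) \<and> [a = b + i] (mod 4)"
    unfolding s using elem_cong_p elem_cong_q cong_refl by (intro exI conjI)
next
  assume "v < p * q \<and>
    (\<exists>a b. [int v = g ^ a] (mod int p) \<and> [int v = g ^ b] (mod int q) \<and> [a = b + i] (mod 4))"
  then obtain a b where v: "v < p * q" and a: "[int v = g ^ a] (mod int p)"
    and b: "[int v = g ^ b] (mod int q)" and ab: "[a = b + i] (mod 4)" by (elim conjE exE) (rule that)
  \<comment> \<open>\<open>a'\<close> represents \<open>a - i\<close> modulo \<open>p - 1\<close>
    without subtraction of natural numbers.\<close>
  define a' where "a' = a + (p - 2) * i"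
  have p1: "p - 1 > 0" "q - 1 > 0" using prime_gt_1_nat[OF p] prime_gt_1_nat[OF q] by simp_all
  have "a' + i = a + (p - 1) * i"
    using p1 by (cases p; cases "p - 1") (auto simp: a'_def algebra_simps)
  then have a'p: "[a' + i = a] (mod (p - 1))" by (simp add: cong_def)
  then have "[a' + i = a] (mod 4)" using dvd_pq(1) by (rule cong_dvd_modulus_nat)
  then have "[a' + i = b + i] (mod 4)" using ab by (rule cong_trans)
  \<comment> \<open>Since the gcd is 4, the condition on the index is exactly the compatibility
    needed to find one exponent \<open>s\<close> for both primes.\<close>
  then have "[a' = b] (mod gcd (p - 1) (q - 1))" by (simp only: cong_add_rcancel_nat gcd4)
  then obtain s where s: "s < e" "[s = a'] (mod (p - 1))" "[s = b] (mod (q - 1))"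
    unfolding e_eq_lcm using p1 by (rule cong_gcd_solve_nat)
  have "[s + i = a' + i] (mod (p - 1))" using s(2) by (simp only: cong_add_rcancel_nat)
  then have "[s + i = a] (mod (p - 1))" using a'p by (rule cong_trans)
  then have "[int (elem i s) = int v] (mod int p)"
    using elem_cong_p[of i s] a int_primroot_power_cong_iff[OF p primroot_p, of "s + i" a]
    by (simp only: cong_def)
  moreover have "[int (elem i s) = int v] (mod int q)"
    using elem_cong_q[of i s] b s(3) int_primroot_power_cong_iff[OF q primroot_q, of s b]
    by (simp only: cong_def)
  ultimately have "[int (elem i s) = int v] (mod int (p * q))" by (simp only: cong_pq_iff)
  then have "elem i s = v"
    using v elem_less cong_less_modulus_unique_nat by (simp only: cong_int_iff)
  then show "v \<in> D i" using s(1) by (auto simp: D_eq)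
qed

text \<open>This lets shifted indices such as \<open>m + k + 2\<close> name one of the four
  classes.\<close>

lemma D_cong: "[i = j] (mod 4) \<Longrightarrow> D i = D j"
proof -
  assume ij: "[i = j] (mod 4)"
  have "[a = b + i] (mod 4) \<longleftrightarrow> [a = b + j] (mod 4)" for a b
    using ij by (meson cong_add_lcancel_nat cong_sym cong_trans)
  then show "D i = D j" by (auto simp: mem_D_iff)
qed

text \<open>Logarithms are determined modulo \<open>p - 1\<close> and \<open>q - 1\<close>, both
  multiples of 4, so their difference modulo 4 is well defined.\<close>

lemma D_unique:
  assumes "v \<in> D i" and "v \<in> D j"
  shows "[i = j] (mod 4)"
proof -
  from assms obtain a b a' b' where
    "[int v = g ^ a] (mod int p)" "[int v = g ^ b] (mod int q)" and ab: "[a = b + i] (mod 4)"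
    and "[int v = g ^ a'] (mod int p)" "[int v = g ^ b'] (mod int q)" and ab': "[a' = b' + j] (mod 4)"
    unfolding mem_D_iff by blast
  then have "[g ^ a = g ^ a'] (mod int p)" "[g ^ b = g ^ b'] (mod int q)"
    by (simp_all only: cong_def)
  then have "[a = a'] (mod (p - 1))" "[b = b'] (mod (q - 1))"
    by (simp_all only: int_primroot_power_cong_iff[OF p primroot_p] int_primroot_power_cong_iff[OF q primroot_q])
  then have "[a = a'] (mod 4)" and bb': "[b = b'] (mod 4)"
    using cong_dvd_modulus_nat dvd_pq by blast+
  moreover from bb' have "[b + j = b' + j] (mod 4)" by (simp only: cong_add_rcancel_nat)
  ultimately have "[b + i = b + j] (mod 4)" using ab ab' by (meson cong_sym cong_trans)
  then show ?thesis by (simp only: cong_add_lcancel_nat)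
qed

lemma D_unique_less: "v \<in> D i \<Longrightarrow> v \<in> D j \<Longrightarrow> i < 4 \<Longrightarrow> j < 4 \<Longrightarrow> i = j"
  using D_unique cong_less_modulus_unique_nat by blast

lemma D_not_dvd:
  assumes "v \<in> D i"
  shows "\<not> p dvd v" "\<not> q dvd v"
proof -
  from assms obtain a b where "[int v = g ^ a] (mod int p)" "[int v = g ^ b] (mod int q)"
    unfolding mem_D_iff by blast
  then show "\<not> p dvd v" "\<not> q dvd v"
    using int_primroot_not_dvd[OF p primroot_p] int_primroot_not_dvd[OF q primroot_q]
    by (metis cong_dvd_iff int_dvd_int_iff)+
qed

lemma ex_D:
  assumes "v < p * q" "\<not> p dvd v" "\<not> q dvd v"
  shows "\<exists>i<4. v \<in> D i"
proof -
  obtain a where a: "[int v = g ^ a] (mod int p)"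
    using int_primroot_log[OF p primroot_p assms(2)] .
  obtain b where b: "[int v = g ^ b] (mod int q)"
    using int_primroot_log[OF q primroot_q assms(3)] .
  \<comment> \<open>Modulo 4, \<open>3 * b\<close> is \<open>- b\<close>, so \<open>i\<close> is the
    difference of the two logarithms.\<close>
  define i where "i = (a + 3 * b) mod 4"
  have "b + (a + 3 * b) = a + 4 * b" by simp
  then have "[a = b + i] (mod 4)" unfolding i_def cong_def by (metis mod_add_right_eq mod_mult_self2)
  then have "v \<in> D i" unfolding mem_D_iff using assms(1) a b by blast
  moreover have "i < 4" by (simp add: i_def)
  ultimately show ?thesis by blast
qed

text \<open>Reduction modulo \<open>p\<close> and \<open>q\<close> determines \<open>s\<close>
  modulo \<open>p - 1\<close> and \<open>q - 1\<close>, hence modulo their lcm, which is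
  \<open>e\<close>.\<close>

lemma inj_on_elem: "inj_on (elem i) {..<e}"
proof (rule inj_onI)
  fix s t assume st: "s \<in> {..<e}" "t \<in> {..<e}" "elem i s = elem i t"
  have "[g ^ (s + i) = g ^ (t + i)] (mod int p)" "[g ^ s = g ^ t] (mod int q)"
    using elem_cong_p[of i s] elem_cong_p[of i t] elem_cong_q[of i s] elem_cong_q[of i t] st(3)
    by (simp_all only: cong_def)
  then have "[s = t] (mod (p - 1))" "[s = t] (mod (q - 1))"
    by (simp_all only: int_primroot_power_cong_iff[OF p primroot_p]
        int_primroot_power_cong_iff[OF q primroot_q] cong_add_rcancel_nat)
  then have "[int s = int t] (mod int e)"
    by (simp add: cong_iff_dvd_diff e_eq_lcm flip: cong_int_iff lcm_int_int_eq)
  then show "s = t" using st by (simp add: cong_int_iff cong_less_modulus_unique_nat)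
qed

lemma card_D: "card (D i) = e"
  by (simp add: D_eq card_image inj_on_elem)

lemma sum_D: "(\<Sum>v\<in>D i. F v) = (\<Sum>s<e. F (elem i s))"
  by (simp add: D_eq sum.reindex inj_on_elem)

text \<open>Residues are sorted into multiples of \<open>q\<close>, nonzero multiples of
  \<open>p\<close>, and units. The residue 0 is counted with the multiples of \<open>q\<close>,
  where the sequence has the same value 2.\<close>

lemma sum_split:
  "(\<Sum>u<p * q. F u) =
    (\<Sum>j<p. F (j * q)) + (\<Sum>j\<in>{1..<q}. F (j * p)) + (\<Sum>k<4. \<Sum>u\<in>D k. F u)"
    (is "_ = ?rhs")
proof -
  have gt: "p > 0" "q > 0" using p q by (simp_all add: prime_gt_0_nat)
  define Q where "Q = (\<lambda>j. j * q) ` {..<p}"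
  define P where "P = (\<lambda>j. j * p) ` {1..<q}"
  define U where "U = (\<Union>k<4. D k)"
  have disj: "Q \<inter> P = {}"
  proof -
    have False if "j * q = k * p" "1 \<le> k" "k < q" for j k
    proof -
      have "q dvd k * p" using that(1) by (metis dvd_triv_right)
      then have "q dvd k" using coprime_pq by (simp add: coprime_commute coprime_dvd_mult_left_iff)
      then show False using that by (auto dest: dvd_imp_le)
    qed
    then show ?thesis unfolding Q_def P_def by fastforce
  qed
  have disjU: "(Q \<union> P) \<inter> U = {}"
    using D_not_dvd dvd_triv_right unfolding Q_def P_def U_def by blast
  have all: "{..<p * q} = (Q \<union> P) \<union> U"
  proof (intro equalityI subsetI)
    fix u assume "u \<in> {..<p * q}"
    then have u: "u < p * q" by simp
    show "u \<in> (Q \<union> P) \<union> U"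
    proof (cases "q dvd u")
      case True
      then obtain j where "u = j * q" by (metis dvdE mult.commute)
      then show ?thesis using u by (auto simp: Q_def)
    next
      case nq: False
      show ?thesis
      proof (cases "p dvd u")
        case True
        then obtain j where j: "u = j * p" by (metis dvdE mult.commute)
        moreover have "j > 0" using nq j by (cases j) auto
        moreover have "j < q" using u j by (simp add: mult.commute)
        ultimately show ?thesis by (auto simp: P_def)
      next
        case False
        then show ?thesis using ex_D[OF u False nq] by (auto simp: U_def)
      qed
    qed
  next
    fix u assume "u \<in> (Q \<union> P) \<union> U"
    then show "u \<in> {..<p * q}"
      using gt by (auto simp: Q_def P_def U_def mem_D_iff mult.commute)
  qed
  have "(\<Sum>u<p * q. F u) = (\<Sum>u\<in>Q. F u) + (\<Sum>u\<in>P. F u) + (\<Sum>u\<in>U. F u)"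
    unfolding all using disj disjU
    by (simp add: sum.union_disjoint Q_def P_def U_def)
  also have "(\<Sum>u\<in>Q. F u) = (\<Sum>j<p. F (j * q))"
    unfolding Q_def using gt by (subst sum.reindex) (auto intro: inj_onI)
  also have "(\<Sum>u\<in>P. F u) = (\<Sum>j\<in>{1..<q}. F (j * p))"
    unfolding P_def using gt by (subst sum.reindex) (auto intro: inj_onI)
  also have "(\<Sum>u\<in>U. F u) = (\<Sum>k<4. \<Sum>u\<in>D k. F u)"
    unfolding U_def using D_unique_less by (subst sum.UNION_disjoint) auto
  finally show ?thesis .
qed

section \<open>Values of the sequence on units, multiples of \<open>q\<close> and multiples of
  \<open>p\<close>\<close>

lemma quaternary_seq_D:
  assumes "k < 4" "u \<in> D k"
  shows "quaternary_seq p q g h u = of_nat k"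
proof -
  have "u < p * q" "\<not> p dvd u" "\<not> q dvd u"
    using assms(2) D_not_dvd by (simp only: mem_D_iff, blast, blast)
  moreover have "u \<noteq> 0" using \<open>\<not> p dvd u\<close> by (cases u) auto
  moreover have "(THE i. i < 4 \<and> u \<in> D i) = k"
    using assms D_unique_less by (intro the_equality) auto
  ultimately show ?thesis
    by (auto simp: quaternary_seq_def Let_def)
qed

lemma quaternary_seq_mult_q:
  assumes "j < p"
  shows "quaternary_seq p q g h (j * q) = 2"
proof -
  have "j * q < p * q" using assms q by (simp add: prime_gt_0_nat)
  moreover have "j * q \<in> {j * q | j. 1 \<le> j \<and> j \<le> p - 1} \<union> {0}"
  proof (cases "j = 0")
    case False
    then have "1 \<le> j \<and> j \<le> p - 1" using assms by simp
    then show ?thesis by blast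
  qed simp
  ultimately show ?thesis by (auto simp: quaternary_seq_def Let_def)
qed

lemma quaternary_seq_mult_p:
  assumes "j \<in> {1..<q}"
  shows "quaternary_seq p q g h (j * p) = 0"
proof -
  have less: "j * p < p * q" using assms p by (simp add: prime_gt_0_nat mult.commute)
  have "\<not> q dvd j * p"
  proof
    assume "q dvd j * p"
    then have "q dvd j" using coprime_pq by (simp add: coprime_commute coprime_dvd_mult_left_iff)
    then show False using assms by (auto dest: dvd_imp_le)
  qed
  then have "\<forall>i. j * p \<noteq> i * q" "j * p \<noteq> 0" by (metis dvd_triv_right, metis dvd_0_right)
  moreover have "\<exists>i. j * p = i * p \<and> 1 \<le> i \<and> i \<le> q - 1" using assms by auto
  ultimately show ?thesis using less by (simp add: quaternary_seq_def Let_def)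
qed

end

section \<open>Character sums over cyclotomic classes\<close>

lemma power_mod_root_of_unity:
  assumes "\<omega> ^ n = (1 :: 'a::comm_ring_1)"
  shows "\<omega> ^ (k mod n) = \<omega> ^ k"
proof -
  have "\<omega> ^ k = \<omega> ^ (n * (k div n) + k mod n)" by simp
  also have "\<dots> = \<omega> ^ (k mod n)" by (simp only: power_add power_mult assms) simp
  finally show ?thesis by simp
qed

lemma primitive_unity_root_power_eq_1_iff:
  assumes "primitive_unity_root n \<beta>" and "n > 0"
  shows "\<beta> ^ k = 1 \<longleftrightarrow> n dvd k"
proof -
  have "\<beta> ^ n = 1" using assms by (simp add: primitive_unity_root_def)
  then have "\<beta> ^ k = \<beta> ^ (k mod n)" by (simp add: power_mod_root_of_unity)
  moreover have "\<beta> ^ (k mod n) = 1 \<longleftrightarrow> k mod n = 0"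
  proof
    have "\<forall>k. 0 < k \<and> k < n \<longrightarrow> \<beta> ^ k \<noteq> 1"
      using assms(1) by (simp add: primitive_unity_root_def)
    moreover assume "\<beta> ^ (k mod n) = 1"
    ultimately show "k mod n = 0" using mod_less_divisor[OF assms(2), of k] by auto
  qed simp
  ultimately show ?thesis by (simp add: dvd_eq_mod_eq_0)
qed

text \<open>Rewrites negative powers of the root as ordinary ones, with \<open>n - 1\<close> in the
  role of -1.\<close>

lemma unit_inverse_root_of_unity:
  assumes "\<beta> ^ n = (1 :: 'a::comm_ring_1)" and "n > 0"
  shows "unit_inverse \<beta> = \<beta> ^ (n - 1)"
  unfolding unit_inverse_def
proof (rule the_equality)
  show inv: "\<beta> * \<beta> ^ (n - 1) = 1" using assms by (simp add: power_eq_if)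
  fix b assume "\<beta> * b = 1"
  then show "b = \<beta> ^ (n - 1)" using inv by (metis mult.assoc mult.commute mult_1)
qed

lemma of_Z4_of_nat: "k < 4 \<Longrightarrow> of_Z4 (of_nat k) = of_nat k"
proof -
  assume "k < 4"
  then have "k = 0 \<or> k = 1 \<or> k = 2 \<or> k = 3" by linarith
  then show ?thesis by (elim disjE) simp_all
qed

lemma coeff_cyc_poly:
  "finite (cyc_class p q g h k) \<Longrightarrow>
    coeff (cyc_poly p q g h k) i = (if i \<in> cyc_class p q g h k then 1 else 0)"
  by (simp add: cyc_poly_def coeff_sum)

lemma coeff_mattson_solomon:
  "coeff (mattson_solomon T s \<alpha>) i =
    (if i < T then \<Sum>u<T. of_Z4 (s u) * unit_inverse \<alpha> ^ (i * u) else 0)"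
  by (simp add: mattson_solomon_def coeff_sum)

lemma sum_lessThan_4: "(\<Sum>k<4::nat. F k) = F 0 + F 1 + F 2 + (F 3 :: 'a::comm_monoid_add)"
  by (simp add: eval_nat_numeral)

text \<open>The exponents form \<open>m\<close> full periods, and each runs once through the nonzero
  residues. Such a period contributes a vanishing geometric sum without its term 1, that is
  -1.\<close>

lemma (in galois_ring_4_like) sum_primroot_powers_root_of_unity:
  assumes r: "prime r" "odd r" "int_primroot r g" and root: "\<omega> ^ r = (1::'a)" "\<omega> \<noteq> 1"
  shows "(\<Sum>s<(r - 1) * m. \<omega> ^ nat (g ^ (s + k) mod int r)) = - of_nat m"
proof -
  let ?F = "\<lambda>s. \<omega> ^ nat (g ^ (s + k) mod int r)"
  have "?F (s + (r - 1)) = ?F s" for s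
  proof -
    have "[s + (r - 1) + k = s + k] (mod (r - 1))"
      unfolding cong_def by (metis add.assoc add.commute mod_add_self2)
    then have "[g ^ (s + (r - 1) + k) = g ^ (s + k)] (mod int r)"
      by (simp only: int_primroot_power_cong_iff[OF r(1,3)])
    then show ?thesis by (simp only: cong_def)
  qed
  then have "(\<Sum>s<(r - 1) * m. ?F s) = of_nat m * (\<Sum>s<r - 1. ?F s)"
    by (rule sum_periodic)
  also have "(\<Sum>s<r - 1. ?F s) = (\<Sum>x\<in>{1..<r}. \<omega> ^ x)"
    using bij_betw_int_primroot_powers[OF r(1,3)] by (rule sum.reindex_bij_betw)
  also have "\<dots> = (\<Sum>x<r. \<omega> ^ x) - 1"
    using prime_gt_0_nat[OF r(1)]
    by (simp add: lessThan_atLeast0 sum.atLeast_Suc_lessThan)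
  also have "(\<Sum>x<r. \<omega> ^ x) = 0" using root r(2) by (intro sum_powers_root_of_unity)
  finally show ?thesis by simp
qed

locale cyclotomic_sums =
  cyclotomic_classes p q g h + galois_ring_4_like ring_type
  for p q g h and ring_type :: "'a::comm_ring_1 itself"
begin

text \<open>Only the residues modulo \<open>p\<close> of the class elements matter, and these are
  the powers \<open>g ^ (s + i)\<close>; the index merely shifts a sum over full periods.\<close>

lemma sum_D_root_p:
  assumes "\<omega> ^ p = (1::'a)" "\<omega> \<noteq> 1"
  shows "(\<Sum>u\<in>D i. \<omega> ^ u) = - of_nat ((q - 1) div 4)"
proof -
  have "\<omega> ^ elem i s = \<omega> ^ nat (g ^ (s + i) mod int p)" for s
  proof -
    have "nat (g ^ (s + i) mod int p) = nat (int (elem i s) mod int p)"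
      using elem_cong_p[of i s] by (simp only: cong_def)
    also have "\<dots> = elem i s mod p" by (simp flip: of_nat_mod)
    finally show ?thesis by (simp add: power_mod_root_of_unity assms)
  qed
  then show ?thesis
    unfolding sum_D e_eq_p
    using sum_primroot_powers_root_of_unity[OF p odd_pq(1) primroot_p assms] by simp
qed

lemma sum_D_root_q:
  assumes "\<omega> ^ q = (1::'a)" "\<omega> \<noteq> 1"
  shows "(\<Sum>u\<in>D i. \<omega> ^ u) = - of_nat ((p - 1) div 4)"
proof -
  \<comment> \<open>Modulo \<open>q\<close> the factor \<open>h ^ i\<close> is 1, so there is no
    shift; \<open>s + 0\<close> matches the general sum with \<open>k = 0\<close>.\<close>
  have "\<omega> ^ elem i s = \<omega> ^ nat (g ^ (s + 0) mod int q)" for s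
  proof -
    have "nat (g ^ s mod int q) = nat (int (elem i s) mod int q)"
      using elem_cong_q[of i s] by (simp only: cong_def)
    also have "\<dots> = elem i s mod q" by (simp flip: of_nat_mod)
    finally show ?thesis by (simp add: power_mod_root_of_unity assms)
  qed
  then show ?thesis
    unfolding sum_D e_eq_q
    using sum_primroot_powers_root_of_unity[OF q odd_pq(2) primroot_q assms, where k = 0] by simp
qed

text \<open>In the vanishing sum over all residues, the multiples of \<open>q\<close> contribute 0
  and the nonzero multiples of \<open>p\<close> contribute -1, which leaves 1 for the units.\<close>

lemma sum_D_total:
  assumes "\<omega> ^ (p * q) = (1::'a)" "\<omega> ^ p \<noteq> 1" "\<omega> ^ q \<noteq> 1"
  shows "(\<Sum>k<4. \<Sum>u\<in>D k. \<omega> ^ u) = 1"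
proof -
  have "\<omega> \<noteq> 1" using assms(2) by auto
  then have "0 = (\<Sum>u<p * q. \<omega> ^ u)"
    using assms(1) odd_pq by (intro sum_powers_root_of_unity[symmetric]) auto
  also have "\<dots> = (\<Sum>j<p. (\<omega> ^ q) ^ j) + (\<Sum>j\<in>{1..<q}. (\<omega> ^ p) ^ j) + (\<Sum>k<4. \<Sum>u\<in>D k. \<omega> ^ u)"
    unfolding sum_split by (simp add: mult.commute flip: power_mult)
  also have "(\<Sum>j<p. (\<omega> ^ q) ^ j) = 0"
    using assms odd_pq by (intro sum_powers_root_of_unity) (simp_all add: mult.commute flip: power_mult)
  also have "(\<Sum>j\<in>{1..<q}. (\<omega> ^ p) ^ j) = (\<Sum>j<q. (\<omega> ^ p) ^ j) - 1"
    using prime_gt_0_nat[OF q] by (simp add: lessThan_atLeast0 sum.atLeast_Suc_lessThan)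
  also have "(\<Sum>j<q. (\<omega> ^ p) ^ j) = 0"
    using assms odd_pq by (intro sum_powers_root_of_unity) (simp_all flip: power_mult)
  finally show ?thesis by (simp add: algebra_simps)
qed

lemma sum_quaternary_seq:
  "(\<Sum>u<p * q. of_Z4 (quaternary_seq p q g h u) * \<omega> ^ u) =
    2 * (\<Sum>j<p. (\<omega> ^ q) ^ j) + (\<Sum>k<4. of_nat k * (\<Sum>u\<in>D k. (\<omega>::'a) ^ u))"
proof -
  have "(\<Sum>j<p. of_Z4 (quaternary_seq p q g h (j * q)) * \<omega> ^ (j * q)) = 2 * (\<Sum>j<p. (\<omega> ^ q) ^ j)"
    by (simp add: quaternary_seq_mult_q sum_distrib_left mult.commute[of q] flip: power_mult)
  moreover have "(\<Sum>j\<in>{1..<q}. of_Z4 (quaternary_seq p q g h (j * p)) * \<omega> ^ (j * p)) = 0"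
    by (intro sum.neutral) (simp add: quaternary_seq_mult_p)
  moreover have "(\<Sum>u\<in>D k. of_Z4 (quaternary_seq p q g h u) * \<omega> ^ u) = of_nat k * (\<Sum>u\<in>D k. \<omega> ^ u)"
    if "k < 4" for k
    using that by (simp add: quaternary_seq_D of_Z4_of_nat sum_distrib_left)
  ultimately show ?thesis
    unfolding sum_split by simp
qed

end

section \<open>The index of -1 when \<open>p\<close> is 5 and \<open>q\<close> is 1 modulo 8\<close>

locale cyclotomic_classes_5_1 = cyclotomic_classes +
  assumes p_mod_8: "[p = 5] (mod 8)" and q_mod_8: "[q = 1] (mod 8)"
begin

lemma ex_pq_eq:
  obtains m n where "p = 8 * m + 5" "q = 8 * n + 1"
proof -
  have "p mod 8 = 5" "q mod 8 = 1" using p_mod_8 q_mod_8 by (simp_all add: cong_def)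
  then have "p = 8 * (p div 8) + 5" "q = 8 * (q div 8) + 1" by (metis mult_div_mod_eq)+
  then show ?thesis by (rule that)
qed

text \<open>The residue conditions on \<open>p\<close> and \<open>q\<close> place \<open>-1\<close> in the class with index 2.\<close>

lemma mult_neg_mem_D:
  assumes i: "i \<in> D k" and u: "u \<in> D m"
  shows "(p * q - 1) * i * u mod (p * q) \<in> D (m + k + 2)"
proof -
  obtain a b where a: "[int i = g ^ a] (mod int p)" and b: "[int i = g ^ b] (mod int q)"
    and ab: "[a = b + k] (mod 4)" using i unfolding mem_D_iff by (elim conjE exE) (rule that)
  obtain a' b' where a': "[int u = g ^ a'] (mod int p)" and b': "[int u = g ^ b'] (mod int q)"
    and ab': "[a' = b' + m] (mod 4)" using u unfolding mem_D_iff by (elim conjE exE) (rule that)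
  let ?v = "(p * q - 1) * i * u mod (p * q)"
  \<comment> \<open>The natural number \<open>p * q - 1\<close> stands for -1 modulo
    \<open>p * q\<close>.\<close>
  have "int (p * q - 1) = int (p * q) - 1" using pq_pos by linarith
  then have v: "[int ?v = - 1 * int i * int u] (mod int (p * q))"
    by (simp add: of_nat_mod cong_def) (simp add: cong_iff_dvd_diff flip: cong_def, simp add: algebra_simps)
  have "[- 1 * int i * int u = g ^ ((p - 1) div 2) * g ^ a * g ^ a'] (mod int p)"
    using a a' int_primroot_half[OF p primroot_p odd_pq(1)] by (intro cong_mult) (auto intro: cong_sym)
  with v have vp: "[int ?v = g ^ ((p - 1) div 2 + a + a')] (mod int p)"
    unfolding power_add cong_pq_iff by (blast intro: cong_trans)
  have "[- 1 * int i * int u = g ^ ((q - 1) div 2) * g ^ b * g ^ b'] (mod int q)"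
    using b b' int_primroot_half[OF q primroot_q odd_pq(2)] by (intro cong_mult) (auto intro: cong_sym)
  with v have vq: "[int ?v = g ^ ((q - 1) div 2 + b + b')] (mod int q)"
    unfolding power_add cong_pq_iff by (blast intro: cong_trans)
  \<comment> \<open>The logarithms of -1 are \<open>(p - 1) / 2\<close>, which is 2 modulo 4, and
    \<open>(q - 1) / 2\<close>, which is 0 modulo 4; their difference gives the extra index
    2.\<close>
  obtain t t' where "p = 8 * t + 5" "q = 8 * t' + 1" by (rule ex_pq_eq)
  then have "(p - 1) div 2 = 2 + 4 * t" "(q - 1) div 2 = 0 + 4 * t'" by simp_all
  then have "[(p - 1) div 2 = 2] (mod 4)" "[(q - 1) div 2 = 0] (mod 4)"
    by (simp_all only: cong_def mod_mult_self2)
  with ab ab' have "[(p - 1) div 2 + a + a' = 2 + (b + k) + (b' + m)] (mod 4)"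
    and "[(q - 1) div 2 + b + b' + (m + k + 2) = 0 + b + b' + (m + k + 2)] (mod 4)"
    by (blast intro: cong_add cong_refl)+
  then have "[(p - 1) div 2 + a + a' = (q - 1) div 2 + b + b' + (m + k + 2)] (mod 4)"
    by (simp add: cong_def ac_simps)
  then show ?thesis unfolding mem_D_iff using vp vq pq_pos mod_less_divisor by blast
qed

text \<open>Multiplication by the unit \<open>- i\<close> is injective and maps one class into
  another of the same size \<open>e\<close>, so it only reindexes the sum.\<close>

lemma sum_D_mult_neg:
  assumes i: "i \<in> D k" and root: "\<beta> ^ (p * q) = (1::'a::comm_ring_1)"
  shows "(\<Sum>u\<in>D m. \<beta> ^ ((p * q - 1) * i * u)) = (\<Sum>v\<in>D (m + k + 2). \<beta> ^ v)"
proof -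
  let ?f = "\<lambda>u. (p * q - 1) * i * u mod (p * q)"
  have "coprime i p" "coprime i q"
    using prime_imp_coprime[OF p] prime_imp_coprime[OF q] D_not_dvd[OF i] coprime_commute by blast+
  moreover have "coprime (p * q - 1) (p * q)" using pq_pos by (rule coprime_diff_one_left_nat)
  ultimately have coprime: "coprime ((p * q - 1) * i) (p * q)"
    by (simp only: coprime_mult_left_iff coprime_mult_right_iff)
  have inj: "inj_on ?f (D m)"
  proof (rule inj_onI)
    fix u v assume uv: "u \<in> D m" "v \<in> D m" "?f u = ?f v"
    then have "[(p * q - 1) * i * u = (p * q - 1) * i * v] (mod (p * q))" unfolding cong_def by simp
    then have "[u = v] (mod (p * q))" using coprime by (simp only: cong_mult_lcancel_nat)
    moreover have "u < p * q" "v < p * q" using uv(1,2) by (simp_all only: mem_D_iff)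
    ultimately show "u = v" by (rule cong_less_modulus_unique_nat)
  qed
  moreover have "?f ` D m = D (m + k + 2)"
  proof (rule card_subset_eq)
    show "?f ` D m \<subseteq> D (m + k + 2)" using mult_neg_mem_D[OF i] by blast
    show "card (?f ` D m) = card (D (m + k + 2))" using inj by (simp only: card_image card_D)
  qed simp
  ultimately have "bij_betw ?f (D m) (D (m + k + 2))" by (simp add: bij_betw_def)
  then have "(\<Sum>v\<in>D (m + k + 2). \<beta> ^ v) = (\<Sum>u\<in>D m. \<beta> ^ ?f u)"
    by (rule sum.reindex_bij_betw[symmetric])
  then show ?thesis by (simp only: power_mod_root_of_unity[OF root])
qed

end

section \<open>The spectrum of the quaternary sequence\<close>

locale cyclotomic_spectrum =
  cyclotomic_sums p q g h ring_type + cyclotomic_classes_5_1 p q g h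
  for p q g h and ring_type :: "'a::comm_ring_1 itself" +
  fixes \<beta> :: 'a
  assumes primitive: "primitive_unity_root (p * q) \<beta>"
begin

definition \<rho> :: 'a where
  "\<rho> = (\<Sum>u\<in>D 1. \<beta> ^ u) + 2 * (\<Sum>u\<in>D 2. \<beta> ^ u) + 3 * (\<Sum>u\<in>D 3. \<beta> ^ u)"

lemma power_eq_1_iff: "\<beta> ^ k = 1 \<longleftrightarrow> p * q dvd k"
  using primitive pq_pos by (rule primitive_unity_root_power_eq_1_iff)

lemma root: "\<beta> ^ (p * q) = 1"
  by (simp add: power_eq_1_iff)

text \<open>This is \<open>\<beta>\<close> to the power \<open>- i\<close>.\<close>

definition \<gamma> :: "nat \<Rightarrow> 'a" where
  "\<gamma> i = \<beta> ^ ((p * q - 1) * i)"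

lemma \<gamma>_power_eq_1_iff: "\<gamma> i ^ k = 1 \<longleftrightarrow> p * q dvd i * k"
proof -
  have "coprime (p * q) (p * q - 1)"
    using coprime_diff_one_left_nat[OF pq_pos] coprime_commute by blast
  then show ?thesis
    unfolding \<gamma>_def power_mult[symmetric] power_eq_1_iff mult.assoc
    by (rule coprime_dvd_mult_right_iff)
qed

text \<open>Evaluates the contribution of the multiples of \<open>q\<close> when all
  \<open>p\<close> powers in it are 1.\<close>

lemma two_mult_of_nat_p: "2 * of_nat p = (2::'a)"
proof -
  obtain m n where "p = 8 * m + 5" by (rule ex_pq_eq)
  then have "[2 * p = 2] (mod 4)" by (simp add: cong_def) presburger
  then have "(of_nat (2 * p) :: 'a) = of_nat 2" by (rule of_nat_cong_4)
  then show ?thesis by simp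
qed

text \<open>For \<open>i < p * q\<close> this is the coefficient of \<open>X^i\<close> in the
  Mattson-Solomon polynomial.\<close>

definition spectrum :: "nat \<Rightarrow> 'a" where
  "spectrum i = (\<Sum>u<p * q. of_Z4 (quaternary_seq p q g h u) * \<gamma> i ^ u)"

text \<open>Each class sum is its size \<open>e\<close>, a multiple of 4, so only the term
  \<open>2 * p\<close> survives.\<close>

lemma spectrum_0: "spectrum 0 = 2"
proof -
  obtain m n where mn: "p = 8 * m + 5" "q = 8 * n + 1" by (rule ex_pq_eq)
  have "e = 4 * (2 * n * (2 * m + 1))" unfolding e_eq_q using mn by simp
  then have "(of_nat e :: 'a) = 0" by (simp only: of_nat_mult of_nat_numeral four_eq_0) simp
  then show ?thesis
    unfolding spectrum_def sum_quaternary_seq by (simp add: \<gamma>_def card_D two_mult_of_nat_p)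
qed

text \<open>Now \<open>\<gamma> i\<close> is a nontrivial \<open>q\<close>-th root of unity. The
  class sums share the odd value \<open>- (p - 1) / 4\<close> and their weights add up to 6, so they
  contribute 2 modulo 4 and cancel \<open>2 * p\<close>.\<close>

lemma spectrum_p_dvd:
  assumes "p dvd i" "\<not> q dvd i"
  shows "spectrum i = 0"
proof -
  obtain m n where mn: "p = 8 * m + 5" "q = 8 * n + 1" by (rule ex_pq_eq)
  have ne: "\<gamma> i \<noteq> 1" using \<gamma>_power_eq_1_iff[of i 1] assms(2) by (auto dest: dvd_mult_right)
  have eq: "\<gamma> i ^ q = 1" using assms(1) by (simp add: \<gamma>_power_eq_1_iff mult_dvd_mono)
  have "(p - 1) div 4 = 2 * m + 1" using mn by simp
  then have "spectrum i = 2 + 6 * (- of_nat (2 * m + 1))"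
    unfolding spectrum_def sum_quaternary_seq sum_D_root_q[OF eq ne] sum_lessThan_4 eq
    by (simp add: two_mult_of_nat_p)
  also have "\<dots> = 4 * (- 1 - 3 * of_nat m)" by (simp add: algebra_simps)
  finally show ?thesis by (simp only: four_eq_0 mult_zero_left)
qed

text \<open>Now \<open>\<gamma> i\<close> is a nontrivial \<open>p\<close>-th root of unity. The
  geometric sum vanishes, and 6 times the even common class sum is 0 modulo 4.\<close>

lemma spectrum_q_dvd:
  assumes "q dvd i" "\<not> p dvd i"
  shows "spectrum i = 0"
proof -
  obtain m n where mn: "p = 8 * m + 5" "q = 8 * n + 1" by (rule ex_pq_eq)
  have ne: "\<gamma> i \<noteq> 1" using \<gamma>_power_eq_1_iff[of i 1] assms(2) by (auto dest: dvd_mult_left)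
  have eq: "\<gamma> i ^ p = 1"
    using assms(1) by (simp add: \<gamma>_power_eq_1_iff mult_dvd_mono mult.commute[of p q])
  have "\<gamma> i ^ q \<noteq> 1"
    using assms(2) prime_gt_0_nat[OF q] by (simp add: \<gamma>_power_eq_1_iff)
  then have zero: "(\<Sum>j<p. (\<gamma> i ^ q) ^ j) = 0"
    using root odd_pq(1) eq
    by (intro sum_powers_root_of_unity) (simp_all add: mult.commute[of q] flip: power_mult, simp add: power_mult)
  have "(q - 1) div 4 = 2 * n" using mn by simp
  then have "spectrum i = 6 * (- of_nat (2 * n))"
    unfolding spectrum_def sum_quaternary_seq sum_D_root_p[OF eq ne] sum_lessThan_4 zero
    by (simp add: algebra_simps)
  also have "\<dots> = 4 * (- 3 * of_nat n)" by (simp add: algebra_simps)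
  finally show ?thesis by (simp only: four_eq_0 mult_zero_left)
qed

text \<open>With \<open>j = m + k + 2\<close> the weight \<open>m\<close> becomes
  \<open>j - (k + 2)\<close> modulo 4. Since the four class sums at \<open>\<beta>\<close> add up to
  1, the result is \<open>\<rho> - (k + 2)\<close>, and -2 equals 2.\<close>

lemma spectrum_D:
  assumes i: "i \<in> D k" and k: "k < 4"
  shows "spectrum i = \<rho> + 2 - of_nat k"
proof -
  note ndvd = D_not_dvd[OF i]
  define B where "B m = (\<Sum>u\<in>D m. \<beta> ^ u)" for m
  have B_sum: "(\<Sum>u\<in>D m. \<gamma> i ^ u) = B (m + k + 2)" for m
    unfolding \<gamma>_def B_def using sum_D_mult_neg[OF i root] by (simp only: power_mult)
  have B_wrap: "B 4 = B 0" "B 5 = B 1" "B 6 = B 2" "B 7 = B 3" "B 8 = B 0"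
    unfolding B_def by (simp_all add: cong_def D_cong[of 4 0] D_cong[of 5 1] D_cong[of 6 2]
        D_cong[of 7 3] D_cong[of 8 0])
  have "\<gamma> i ^ q \<noteq> 1"
    using ndvd prime_gt_0_nat[OF q] by (simp add: \<gamma>_power_eq_1_iff)
  moreover have "(\<gamma> i ^ q) ^ p = 1"
    by (simp add: \<gamma>_power_eq_1_iff mult.commute[of q p] flip: power_mult)
  ultimately have zero: "(\<Sum>j<p. (\<gamma> i ^ q) ^ j) = 0"
    using odd_pq(1) by (intro sum_powers_root_of_unity)
  have "\<not> p * q dvd p" "\<not> p * q dvd q"
    using prime_gt_1_nat[OF p] prime_gt_1_nat[OF q] by (auto dest: dvd_imp_le)
  then have "(\<Sum>k<4. B k) = 1"
    unfolding B_def using root power_eq_1_iff by (intro sum_D_total) auto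
  \<comment> \<open>Eliminating \<open>B 0\<close> makes both sides linear in \<open>B 1\<close>,
    \<open>B 2\<close>, \<open>B 3\<close>.\<close>
  then have B0: "B 0 = 1 - B 1 - B 2 - B 3" by (simp add: sum_lessThan_4 algebra_simps)
  have spec: "spectrum i = B (1 + k + 2) + 2 * B (2 + k + 2) + 3 * B (3 + k + 2)"
    unfolding spectrum_def sum_quaternary_seq zero B_sum sum_lessThan_4
    by (simp only: of_nat_0 of_nat_1 of_nat_numeral mult_zero_left mult_zero_right add_0 mult_1)
  have \<rho>: "\<rho> = B 1 + 2 * B 2 + 3 * B 3" by (simp add: \<rho>_def B_def)
  \<comment> \<open>In each case below, \<open>z\<close> is a quarter of the formal difference of
    the two sides.\<close>
  have four: "x = y" if "x - y = 4 * z" for x y z :: 'a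
    using that four_eq_0 by simp
  have index_eqs: "1 + 0 + 2 = (3::nat)" "2 + 0 + 2 = (4::nat)" "3 + 0 + 2 = (5::nat)"
    "1 + 1 + 2 = (4::nat)" "2 + 1 + 2 = (5::nat)" "3 + 1 + 2 = (6::nat)"
    "1 + 2 + 2 = (5::nat)" "2 + 2 + 2 = (6::nat)" "3 + 2 + 2 = (7::nat)"
    "1 + 3 + 2 = (6::nat)" "2 + 3 + 2 = (7::nat)" "3 + 3 + 2 = (8::nat)"
    by simp_all
  have "k = 0 \<or> k = 1 \<or> k = 2 \<or> k = 3" using k by linarith
  then show ?thesis
  proof (elim disjE)
    assume k: "k = 0"
    show ?thesis unfolding spec \<rho> k index_eqs B_wrap B0
      by (rule four[where z = "- B 2 - B 3"]) (simp add: algebra_simps)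
  next
    assume k: "k = 1"
    show ?thesis unfolding spec \<rho> k index_eqs B_wrap B0
      by (rule four[where z = "- B 3"]) (simp add: algebra_simps)
  next
    assume k: "k = 2"
    show ?thesis unfolding spec \<rho> k index_eqs B_wrap B0
      by (rule four[where z = "0"]) (simp add: algebra_simps)
  next
    assume k: "k = 3"
    show ?thesis unfolding spec \<rho> k index_eqs B_wrap B0
      by (rule four[where z = "1 - B 1 - B 2 - B 3"]) (simp add: algebra_simps)
  qed
qed

section \<open>Assembling the polynomial from its coefficients\<close>

lemma coeff_mattson_solomon_quaternary_seq:
  "coeff (mattson_solomon (p * q) (quaternary_seq p q g h) \<beta>) i =
    (if i < p * q then spectrum i else 0)"
  unfolding coeff_mattson_solomon unit_inverse_root_of_unity[OF root pq_pos] spectrum_def \<gamma>_def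
  by (simp only: power_mult)

lemma map_poly_cyc_poly:
  "(map_poly of_Z4 (cyc_poly p q g h k) :: 'a poly) = (\<Sum>u\<in>D k. monom 1 u)"
  by (intro poly_eqI) (simp add: coeff_map_poly coeff_cyc_poly coeff_sum)

lemma mattson_solomon_quaternary_seq:
  "mattson_solomon (p * q) (quaternary_seq p q g h) \<beta> =
    2 + (\<Sum>k\<in>{0..3}. smult (\<rho> + 2 - of_nat k) (\<Sum>u\<in>D k. monom 1 u))"
proof (rule poly_eqI)
  fix i
  let ?c = "\<lambda>k. if i \<in> D k then \<rho> + 2 - of_nat k else 0"
  have "{0..3} = {..<4::nat}" by auto
  then have rhs: "coeff (2 + (\<Sum>k\<in>{0..3}. smult (\<rho> + 2 - of_nat k) (\<Sum>u\<in>D k. monom 1 u))) i =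
      (if i = 0 then 2 else 0) + (\<Sum>k<4. ?c k)"
    by (simp add: coeff_sum numeral_poly coeff_pCons if_distrib cong: if_cong split: nat.split)
  show "coeff (mattson_solomon (p * q) (quaternary_seq p q g h) \<beta>) i =
    coeff (2 + (\<Sum>k\<in>{0..3}. smult (\<rho> + 2 - of_nat k) (\<Sum>u\<in>D k. monom 1 u))) i"
    unfolding rhs coeff_mattson_solomon_quaternary_seq
  proof (cases "\<exists>k<4. i \<in> D k")
    case True
    then obtain k where k: "k < 4" "i \<in> D k" by blast
    \<comment> \<open>The classes are disjoint, so at most one summand is nonzero at
      \<open>i\<close>.\<close>
    have "?c l = (if l = k then \<rho> + 2 - of_nat k else 0)" if "l < 4" for l
      using k that D_unique_less by auto
    then have "(\<Sum>l<4. ?c l) = \<rho> + 2 - of_nat k" using k(1) by simp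
    moreover have "i < p * q" using k(2) by (simp only: mem_D_iff)
    moreover have "i \<noteq> 0" using D_not_dvd(1)[OF k(2)] by (metis dvd_0_right)
    ultimately show "(if i < p * q then spectrum i else 0) =
        (if i = 0 then 2 else 0) + (\<Sum>k<4. ?c k)"
      using spectrum_D[OF k(2,1)] by simp
  next
    case False
    then have "(\<Sum>k<4. ?c k) = 0" by simp
    moreover have "(if i < p * q then spectrum i else 0) = (if i = 0 then 2 else 0)"
    proof (cases "i = 0")
      case True
      then show ?thesis using pq_pos by (simp add: spectrum_0)
    next
      case nz: False
      \<comment> \<open>A nonzero index outside all classes is divisible by exactly one of the two
        primes.\<close>
      have "spectrum i = 0" if "i < p * q"
      proof -
        have "\<not> p * q dvd i" using that nz by (auto dest: dvd_imp_le)
        then have "\<not> (p dvd i \<and> q dvd i)" using coprime_pq divides_mult by blast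
        moreover have "p dvd i \<or> q dvd i" using ex_D[OF that] False by blast
        ultimately show ?thesis using spectrum_p_dvd spectrum_q_dvd by blast
      qed
      then show ?thesis using nz by simp
    qed
    ultimately show "(if i < p * q then spectrum i else 0) =
        (if i = 0 then 2 else 0) + (\<Sum>k<4. ?c k)" by simp
  qed
qed

end

theorem theorem3:
  fixes p q :: nat and g h :: int and \<beta> :: "'a::comm_ring_1"
  assumes "prime p" and "prime q" and "p \<noteq> q"
    and "gcd (p - 1) (q - 1) = 4"
    and "int_primroot p g" and "int_primroot q g"
    and "[h = g] (mod int p)" and "[h = 1] (mod int q)"
    and "galois_ring_4 TYPE('a) (ord (p * q) 2)"
    and "primitive_unity_root (p * q) \<beta>"
    and "[p = 5] (mod 8)" and "[q = 1] (mod 8)"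
  shows "mattson_solomon (p * q) (quaternary_seq p q g h) \<beta> =
    (let D = (\<lambda>k. map_poly of_Z4 (cyc_poly p q g h k) :: 'a poly);
         \<rho> = poly (D 1) \<beta> + 2 * poly (D 2) \<beta> + 3 * poly (D 3) \<beta>
     in 2 + (\<Sum>k\<in>{0..3::nat}. smult (\<rho> + 2 - of_nat k) (D k)))"
proof -
  interpret galois_ring_4_like "TYPE('a)"
    using assms(9) by (rule galois_ring_4_imp_like)
  interpret cyclotomic_spectrum p q g h "TYPE('a)" \<beta>
    using assms by unfold_locales
  \<comment> \<open>Evaluating the lifted class polynomials at \<open>\<beta>\<close> gives the
    class sums in the locale constant \<open>\<rho>\<close>.\<close>
  show ?thesis
    unfolding Let_def map_poly_cyc_poly mattson_solomon_quaternary_seq \<rho>_def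
    by (simp add: poly_sum poly_monom)
qed

end
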